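(* Let $\alpha$ and $\lambda$ be positive real numbers and define the operator $T:\mathbb{R}[x]\to\mathbb{R}[x]$ by $$T(p)(x)=p(x)-\lambda\, p(x-\alpha).$$ Then for every $p\in\mathcal{HP}_{\ge\alpha}$, the polynomial $T(p)$ is hyperbolic and $$\operatorname{mesh}(T(p))\ \ge\ \operatorname{mesh}(p).$$ Moreover, if $\lambda\ge 1$, then $T$ preserves the set $\mathcal{HP}^{+}_{\ge\alpha}$, i.e. $T(\mathcal{HP}^{+}_{\ge\alpha})\subseteq\mathcal{HP}^{+}_{\ge\alpha}$.
   Context: A polynomial in $\mathbb{R}[x]$ is called hyperbolic if all its zeros are real; $\mathcal{HP}\subset\mathbb{R}[x]$ denotes the set of hyperbolic polynomials. For $p\in\mathcal{HP}$, $\operatorname{mesh}(p)$ is the minimal distance between its roots; if $p$ has a multiple root, then $\operatorname{mesh}(p):=0$. Polynomials of degree at most $1$ are defined to have mesh $+\infty$. For $\alpha\ge 0$, $\mathcal{HP}_{\ge\alpha}\subset\mathcal{HP}$ is the set of hyperbolic polynomials whose mesh is at least $\alpha$, and $\mathcal{HP}^{+}_{\ge\alpha}\subset\mathcal{HP}_{\ge\alpha}$ is the subset of those having only non-negative zeros. By convention the zero polynomial and the nonzero constants belong to all of these sets (with mesh $+\infty$). *)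

theory Defs
  imports "HOL-Analysis.Analysis" "HOL-Computational_Algebra.Polynomial"
begin

text \<open>The zeros that have to be real are the complex zeros. The zero polynomial
  (for which every complex number is a zero) counts as hyperbolic by convention.\<close>

definition hyperbolic :: "real poly \<Rightarrow> bool" where
  "hyperbolic p \<longleftrightarrow>
     p = 0 \<or> (\<forall>z::complex. poly (map_poly complex_of_real p) z = 0 \<longrightarrow> z \<in> \<real>)"

text \<open>Only meaningful for hyperbolic \<open>p\<close>. A hyperbolic polynomial of degree at least 2
  without multiple roots has at least two and only finitely many real roots, so that the
  infimum below is then a minimum.\<close>

definition mesh :: "real poly \<Rightarrow> ereal" where
  "mesh p =
     (if degree p \<le> 1 then \<infinity>
      else if \<exists>x. order x p \<ge> 2 then 0
      else Inf {ereal \<bar>x - y\<bar> |x y. poly p x = 0 \<and> poly p y = 0 \<and> x \<noteq> y})"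

definition HP :: "real poly set" where
  "HP = {p. hyperbolic p}"

definition HP_ge :: "real \<Rightarrow> real poly set" where
  "HP_ge \<alpha> = {p \<in> HP. ereal \<alpha> \<le> mesh p}"

text \<open>The zero polynomial is again included by convention.\<close>

definition HP_ge_nonneg :: "real \<Rightarrow> real poly set" where
  "HP_ge_nonneg \<alpha> = {p \<in> HP_ge \<alpha>. p = 0 \<or> (\<forall>x. poly p x = 0 \<longrightarrow> 0 \<le> x)}"

definition shift_diff :: "real \<Rightarrow> real \<Rightarrow> real poly \<Rightarrow> real poly" where
  "shift_diff \<alpha> lam p = p - smult lam (pcompose p [:- \<alpha>, 1:])"

lemma poly_shift_diff:
  "poly (shift_diff \<alpha> lam p) x = poly p x - lam * poly p (x - \<alpha>)"
  by (simp add: shift_diff_def poly_pcompose)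

end

theory Submission
  imports Defs "HOL-Computational_Algebra.Fundamental_Theorem_Algebra"
begin

text \<open>
  Let \<open>x\<^sub>0 < x\<^sub>1 < \<dots> < x\<^sub>n\<^sub>-\<^sub>1\<close> be the zeros of \<open>p\<close>; consecutive ones are at least \<open>\<alpha>\<close> apart.
  Write \<open>T p\<close> for \<open>shift_diff \<alpha> lam p\<close>. Where \<open>p (y - \<alpha>) \<noteq> 0\<close>, the equation \<open>T p y = 0\<close> reads
  \<open>\<Prod>i. g (y - x\<^sub>i) = lam\<close> with \<open>g t = t / (t - \<alpha>)\<close>. Zeros of \<open>T p\<close> are compared by means of
  three properties of \<open>g\<close>: it is negative exactly on \<open>(0, \<alpha>)\<close>, it decreases strictly on each
  side of this interval, and it is below \<open>1\<close> on the left side and above \<open>1\<close> on the right side.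

  \<^emph>\<open>Reality and simplicity.\<close> Since \<open>p\<close> vanishes at \<open>x\<^sub>i\<close> and \<open>p(\<cdot> - \<alpha>)\<close> vanishes at
  \<open>x\<^sub>i + \<alpha>\<close>, the polynomial \<open>T p\<close> changes sign on every gap \<open>[x\<^sub>i + \<alpha>, x\<^sub>i\<^sub>+\<^sub>1]\<close>, or the gap
  shrinks to a common zero of the two. These \<open>n - 1\<close> zeros are all of them when \<open>lam = 1\<close>,
  because then the leading terms cancel. Otherwise the remaining factor of \<open>T p\<close> is linear, and the
  sign of \<open>T p\<close> at one end of the configuration shows that its zero lies outside all the gaps:
  to the right of them for \<open>lam > 1\<close>, to the left for \<open>lam < 1\<close>. In either case \<open>T p\<close> has as many
  distinct real zeros as its degree (\<open>T_simple_hyperbolic\<close>).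

  \<^emph>\<open>Mesh.\<close> Suppose \<open>y1 < y2\<close> are zeros of \<open>T p\<close> closer to each other than any two zeros of
  \<open>p\<close>. Then the numbers \<open>y1 - x\<^sub>i\<close> and \<open>y2 - x\<^sub>i\<close> interlace, and none of them lies in
  \<open>(0, \<alpha>)\<close>. If every \<open>y2 - x\<^sub>i\<close> is on the same side of this interval as \<open>y1 - x\<^sub>i\<close>, the
  product decreases strictly from \<open>y1\<close> to \<open>y2\<close>, factor by factor. If one of them has jumped
  across, compare the factor of \<open>y2 - x\<^sub>i\<^sub>+\<^sub>1\<close> with that of \<open>y1 - x\<^sub>i\<close> instead: these two
  arguments are on the same side in the opposite order, and the unmatched factors are
  \<open>g (y2 - x\<^sub>0) > 1\<close> and \<open>g (y1 - x\<^sub>n\<^sub>-\<^sub>1) < 1\<close>, so that the product increases strictly. Both times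
  it cannot equal \<open>lam\<close> at \<open>y1\<close> and at \<open>y2\<close> (\<open>T_roots_not_closer\<close>).

  \<^emph>\<open>Sign of the zeros.\<close> If no zero of \<open>p\<close> is negative and \<open>y < 0\<close>, then \<open>y - \<alpha>\<close> is further
  than \<open>y\<close> from each zero of \<open>p\<close>. So \<open>\<bar>p y\<bar> < \<bar>p (y - \<alpha>)\<bar>\<close>, and \<open>lam \<ge> 1\<close> excludes
  \<open>T p y = 0\<close> (\<open>T_roots_nonneg\<close>).
\<close>

section \<open>Hyperbolic polynomials with simple zeros\<close>

lemma prod_linear_factors_dvd:
  fixes p :: "'a::idom poly"
  assumes "finite S" "\<forall>s\<in>S. poly p s = 0"
  shows "(\<Prod>s\<in>S. [:- s, 1:]) dvd p"
  using assms
proof (induction S rule: finite_induct)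
  case (insert a S)
  then obtain k where k: "p = (\<Prod>s\<in>S. [:- s, 1:]) * k"
    by (auto elim: dvdE)
  have "poly (\<Prod>s\<in>S. [:- s, 1:]) a \<noteq> 0"
    using insert.hyps by (auto simp: poly_prod)
  then have "poly k a = 0"
    using insert.prems k by auto
  then have "[:- a, 1:] dvd k"
    by (simp add: poly_eq_0_iff_dvd)
  then show ?case
    using insert.hyps unfolding k by (simp only: prod.insert not_False_eq_True) (metis dvd_refl mult.commute mult_dvd_mono)
qed simp

lemma degree_prod_linear_factors:
  "degree (\<Prod>s\<in>S. [:- s, 1::'a::idom:]) = card S"
  by (subst degree_prod_sum_eq) auto

lemma map_poly_complex_of_real_mult:
  "map_poly complex_of_real (p * q) = map_poly complex_of_real p * map_poly complex_of_real q"
  by (rule poly_eqI) (simp add: coeff_map_poly coeff_mult)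

lemma poly_map_poly_complex_of_real:
  "poly (map_poly complex_of_real p) (complex_of_real x) = complex_of_real (poly p x)"
  by (induction p) (auto simp: map_poly_pCons)

text \<open>The cofactor of the product over the distinct real zeros has no zero at all: a complex zero
  would be real by hyperbolicity, and would then be a double zero of \<open>p\<close>. By the fundamental theorem
  of algebra the cofactor is constant.\<close>

lemma factorization_of_simple_hyperbolic:
  assumes "hyperbolic p" "p \<noteq> 0" and simple: "\<And>x. order x p < 2"
  shows "p = smult (lead_coeff p) (\<Prod>x\<in>{x. poly p x = 0}. [:- x, 1:])"
proof -
  define P where "P = (\<Prod>x\<in>{x. poly p x = 0}. [:- x, 1:])"
  have fin: "finite {x. poly p x = 0}"
    using \<open>p \<noteq> 0\<close> by (rule poly_roots_finite)
  obtain q where q: "p = P * q"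
    using prod_linear_factors_dvd[OF fin, of p] unfolding P_def by (auto elim: dvdE)
  have "poly q r \<noteq> 0" for r
  proof
    assume r: "poly q r = 0"
    then have pr: "poly p r = 0" using q by simp
    have "[:- r, 1:] dvd P"
      using pr fin unfolding P_def by (intro dvd_prodI) auto
    moreover have "[:- r, 1:] dvd q"
      using r by (simp add: poly_eq_0_iff_dvd)
    ultimately have "[:- r, 1:] ^ 2 dvd p"
      unfolding q power2_eq_square by (rule mult_dvd_mono)
    then show False
      using simple[of r] \<open>p \<noteq> 0\<close> by (simp add: order_divides)
  qed
  moreover have "z \<in> \<real>" if "poly (map_poly complex_of_real q) z = 0" for z
    using that assms(1,2) unfolding hyperbolic_def q by (auto simp: map_poly_complex_of_real_mult)
  ultimately have "poly (map_poly complex_of_real q) z \<noteq> 0" for z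
    by (metis Reals_cases of_real_eq_0_iff poly_map_poly_complex_of_real)
  then have "constant (poly (map_poly complex_of_real q))"
    using fundamental_theorem_of_algebra by blast
  then have "degree q = 0"
    by (simp add: constant_degree degree_map_poly)
  then obtain d where d: "q = [:d:]"
    by (rule degree_eq_zeroE)
  have "lead_coeff P = 1"
    unfolding P_def by (simp add: lead_coeff_prod)
  then have "lead_coeff p = d"
    unfolding q d lead_coeff_mult by simp
  moreover have "p = smult d P"
    using q d by simp
  ultimately show ?thesis
    unfolding P_def by simp
qed

text \<open>A count replaces any examination of complex or multiple zeros: once as many distinct real
  zeros are known as the degree allows, there is no room for a non-real or a repeated one.\<close>

lemma simple_hyperbolic_if_enough_roots:
  assumes "p \<noteq> 0" "finite R" "\<And>x. x \<in> R \<Longrightarrow> poly p x = 0" "degree p \<le> card R"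
  shows "hyperbolic p" "order x p < 2"
proof -
  obtain q where q: "p = (\<Prod>x\<in>R. [:- x, 1:]) * q"
    using prod_linear_factors_dvd[OF assms(2), of p] assms(3) by (auto elim: dvdE)
  have nz: "q \<noteq> 0" "(\<Prod>x\<in>R. [:- x, 1:]) \<noteq> 0"
    using q \<open>p \<noteq> 0\<close> by auto
  then have "degree q = 0"
    using assms(4) unfolding q by (simp add: degree_mult_eq degree_prod_linear_factors)
  then obtain d where d: "q = [:d:]"
    by (rule degree_eq_zeroE)
  have prod: "poly (map_poly complex_of_real (\<Prod>x\<in>R. [:- x, 1:])) z = (\<Prod>x\<in>R. z - of_real x)" for z
    using \<open>finite R\<close>
  proof (induction R rule: finite_induct)
    case (insert a F)
    then show ?case
      by (simp only: prod.insert not_False_eq_True map_poly_complex_of_real_mult poly_mult) (simp add: map_poly_pCons)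
  qed simp
  have eval: "poly (map_poly complex_of_real p) z = (\<Prod>x\<in>R. z - of_real x) * of_real d" for z
  proof -
    have "poly (map_poly complex_of_real [:d:]) z = of_real d"
      by (simp add: map_poly_pCons)
    then show ?thesis
      by (simp only: q d map_poly_complex_of_real_mult poly_mult prod)
  qed
  have "d \<noteq> 0" using nz(1) d by simp
  show "hyperbolic p"
    unfolding hyperbolic_def
  proof (intro disjI2 allI impI)
    fix z assume "poly (map_poly complex_of_real p) z = 0"
    then have "(\<Prod>x\<in>R. z - complex_of_real x) = 0"
      using \<open>d \<noteq> 0\<close> by (simp only: eval mult_eq_0_iff of_real_eq_0_iff simp_thms)
    then show "z \<in> \<real>"
      using \<open>finite R\<close> by auto
  qed
  show "order x p < 2"
  proof (rule ccontr)
    assume "\<not> order x p < 2"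
    then have "[:- x, 1:] ^ 2 dvd p" by (simp add: order_divides)
    then obtain r where r: "p = [:- x, 1:] ^ 2 * r" by (elim dvdE)
    have r0: "r \<noteq> 0" using r \<open>p \<noteq> 0\<close> by auto
    have "R \<subseteq> insert x {y. poly r y = 0}"
      using assms(3) r by auto
    then have "card R \<le> card (insert x {y. poly r y = 0})"
      using poly_roots_finite[OF r0] by (intro card_mono) auto
    also have "\<dots> \<le> Suc (card {y. poly r y = 0})"
      using poly_roots_finite[OF r0] by (simp add: card_insert_if)
    also have "\<dots> \<le> Suc (degree r)"
      using card_poly_roots_bound[OF r0] by simp
    also have "\<dots> < degree p"
      using r0 unfolding r by (simp add: degree_mult_eq degree_power_eq)
    finally show False using assms(4) by simp
  qed
qed

lemma finite_set_increasing_enumeration: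
  fixes S :: "'a::linorder set"
  assumes "finite S"
  obtains x where "bij_betw x {..<card S} S" "\<And>i j. i < j \<Longrightarrow> j < card S \<Longrightarrow> x i < x j"
proof
  define xs where "xs = sorted_list_of_set S"
  have xs: "sorted_wrt (<) xs" "distinct xs" "set xs = S" "length xs = card S"
    using assms unfolding xs_def by auto
  show "bij_betw (\<lambda>i. xs ! i) {..<card S} S"
    by (rule bij_betw_nth) (simp_all only: xs)
  show "\<And>i j. i < j \<Longrightarrow> j < card S \<Longrightarrow> xs ! i < xs ! j"
    using xs(1) unfolding sorted_wrt_iff_nth_less xs(4) by blast
qed

section \<open>Location of the zeros of the transformed polynomial\<close>

text \<open>The zeros are indexed in increasing order, rather than collected in a set, so that each zero
  can be compared with its right neighbour in the products below.\<close>

locale spaced_poly =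
  fixes \<alpha> lam c :: real and n :: nat and x :: "nat \<Rightarrow> real" and p :: "real poly"
  assumes \<alpha>_pos: "\<alpha> > 0" and lam_pos: "lam > 0" and c_nz: "c \<noteq> 0"
    and spaced: "\<And>i j. i < j \<Longrightarrow> j < n \<Longrightarrow> x i + \<alpha> \<le> x j"
    and p_eq: "p = smult c (\<Prod>i<n. [:- x i, 1:])"
begin

abbreviation T :: "real poly" where "T \<equiv> shift_diff \<alpha> lam p"

lemma poly_p: "poly p y = c * (\<Prod>i<n. y - x i)"
  by (simp add: p_eq poly_prod)

lemma poly_p_eq_0_iff: "poly p y = 0 \<longleftrightarrow> (\<exists>i<n. y = x i)"
  using c_nz by (auto simp: poly_p)

lemma p_nz: "p \<noteq> 0"
  using c_nz by (simp add: p_eq)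

lemma degree_p: "degree p = n"
  using c_nz by (simp add: p_eq degree_prod_sum_eq)

lemma lead_coeff_p: "lead_coeff p = c"
  by (simp add: p_eq lead_coeff_prod)

lemma x_mono: "i \<le> j \<Longrightarrow> j < n \<Longrightarrow> x i \<le> x j"
  using spaced[of i j] \<alpha>_pos by (cases "i = j") auto

text \<open>The points \<open>y\<close> and \<open>y - \<alpha>\<close> are separated by the zero \<open>x i\<close> and, by the spacing, by no other
  one. So \<open>p y\<close> and \<open>p (y - \<alpha>)\<close> have opposite signs and cannot have the positive quotient
  \<open>lam\<close>.\<close>

lemma T_nonzero_right_of_root:
  assumes "i < n" "x i < y" "y < x i + \<alpha>"
  shows "poly T y \<noteq> 0"
proof -
  have pos: "0 < (\<Prod>j\<in>{..<n}-{i}. (y - x j) * (y - \<alpha> - x j))"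
  proof (rule prod_pos)
    fix j assume j: "j \<in> {..<n}-{i}"
    show "0 < (y - x j) * (y - \<alpha> - x j)"
    proof (cases "j < i")
      case True
      then show ?thesis using spaced[of j i] assms \<alpha>_pos by (intro mult_pos_pos) auto
    next
      case False
      then show ?thesis using spaced[of i j] j assms \<alpha>_pos by (intro mult_neg_neg) auto
    qed
  qed
  have "poly p y * poly p (y - \<alpha>) = c\<^sup>2 * (\<Prod>j<n. (y - x j) * (y - \<alpha> - x j))"
    by (simp add: poly_p prod.distrib power2_eq_square)
  also have "\<dots> = c\<^sup>2 * (((y - x i) * (y - \<alpha> - x i)) * (\<Prod>j\<in>{..<n}-{i}. (y - x j) * (y - \<alpha> - x j)))"
    using assms(1) by (subst prod.remove[of _ i]) auto
  also have "\<dots> < 0"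
    using pos c_nz assms by (intro mult_pos_neg mult_neg_pos) (auto intro: mult_pos_neg)
  finally have neg: "poly p y * poly p (y - \<alpha>) < 0" .
  have False if "poly p y = lam * poly p (y - \<alpha>)"
    using neg lam_pos unfolding that by (auto simp: mult_less_0_iff zero_less_mult_iff)
  then show ?thesis
    by (auto simp: poly_shift_diff)
qed

text \<open>At the left end of the gap only the term \<open>p y\<close> survives, at the right end only the term
  \<open>- lam * p (y - \<alpha>)\<close>. Both evaluate \<open>p\<close> between the same two consecutive zeros, so that \<open>T\<close>
  has opposite signs at the ends.\<close>

lemma T_root_between:
  assumes "Suc i < n"
  shows "\<exists>y. x i + \<alpha> \<le> y \<and> y \<le> x (Suc i) \<and> poly T y = 0"
proof (cases "x i + \<alpha> = x (Suc i)")
  case True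
  have "poly p (x (Suc i)) = 0" "poly p (x (Suc i) - \<alpha>) = 0"
    using assms True poly_p_eq_0_iff by (force, metis Suc_lessD add_diff_cancel_right')
  then have "poly T (x (Suc i)) = 0"
    by (simp add: poly_shift_diff)
  then show ?thesis using True by auto
next
  case False
  define u where "u = x i + \<alpha>"
  define v where "v = x (Suc i)"
  have uv: "u < v"
    using False spaced[of i "Suc i"] assms by (simp add: u_def v_def)
  have "0 < (\<Prod>j<n. (u - x j) * (v - \<alpha> - x j))"
  proof (rule prod_pos)
    fix j assume j: "j \<in> {..<n}"
    show "0 < (u - x j) * (v - \<alpha> - x j)"
    proof (cases "j \<le> i")
      case True
      then have "x j \<le> x i" using x_mono assms by simp
      then show ?thesis using uv \<alpha>_pos unfolding u_def by (intro mult_pos_pos) auto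
    next
      case False
      then have "v \<le> x j" using x_mono j unfolding v_def by simp
      then show ?thesis using uv \<alpha>_pos by (intro mult_neg_neg) auto
    qed
  qed
  then have "0 < c\<^sup>2 * (\<Prod>j<n. (u - x j) * (v - \<alpha> - x j))"
    using c_nz by simp
  also have "\<dots> = poly p u * poly p (v - \<alpha>)"
    by (simp add: poly_p prod.distrib power2_eq_square)
  finally have "0 < poly p u * poly p (v - \<alpha>)" .
  moreover have "poly p (u - \<alpha>) = 0" "poly p v = 0"
    using assms poly_p_eq_0_iff[of "x i"] poly_p_eq_0_iff[of "x (Suc i)"] Suc_lessD[OF assms]
    unfolding u_def v_def add_diff_cancel_right' by blast+
  then have "poly T u = poly p u" "poly T v = - lam * poly p (v - \<alpha>)"
    by (auto simp: poly_shift_diff)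
  ultimately have "poly T u * poly T v < 0"
    using lam_pos by (simp add: zero_less_mult_iff mult_less_0_iff)
  then obtain y where "u < y" "y < v" "poly T y = 0"
    using poly_IVT[OF uv] by blast
  then show ?thesis unfolding u_def v_def by (intro exI[of _ y]) auto
qed

lemma degree_pcompose_shift: "degree (pcompose p [:- \<alpha>, 1:]) = n"
  by (simp add: degree_pcompose degree_p)

lemma coeff_T_n: "coeff T n = (1 - lam) * c"
proof -
  have "lead_coeff (pcompose p [:- \<alpha>, 1:]) = c"
    by (subst lead_coeff_comp) (simp_all add: lead_coeff_p)
  then show ?thesis
    using lead_coeff_p by (simp add: shift_diff_def degree_pcompose_shift degree_p algebra_simps)
qed

lemma degree_T_le: "degree T \<le> n"
  unfolding shift_diff_def
  by (intro degree_diff_le) (use degree_pcompose_shift degree_p degree_smult_le in \<open>auto intro: order.trans\<close>)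

lemma degree_T_less:
  assumes "lam = 1" "n > 0"
  shows "degree T < n"
  using eq_zero_or_degree_less[OF degree_T_le] coeff_T_n assms by auto

lemma T_nz:
  assumes "n > 0"
  shows "T \<noteq> 0"
proof -
  have "poly p (x 0 - \<alpha>) \<noteq> 0"
  proof
    assume "poly p (x 0 - \<alpha>) = 0"
    then obtain i where "i < n" "x 0 - \<alpha> = x i" by (auto simp: poly_p_eq_0_iff)
    then show False using spaced[of 0 i] \<alpha>_pos by (cases "i = 0") auto
  qed
  moreover have "poly p (x 0) = 0" using assms poly_p_eq_0_iff by blast
  ultimately have "poly T (x 0) \<noteq> 0" using lam_pos by (simp add: poly_shift_diff)
  then show ?thesis by auto
qed

text \<open>Each of the \<open>n - 1\<close> gaps contributes a zero. For \<open>lam \<noteq> 1\<close> one more is needed; it is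
  automatically real, and the point is that it differs from the others. Its position can be read off
  by factoring \<open>T\<close> completely and comparing with the value of \<open>T\<close> at an extreme zero of
  \<open>p\<close> or of its translate, where one of the two terms of \<open>T\<close> vanishes.\<close>

lemma T_simple_hyperbolic:
  assumes "n > 0"
  shows "hyperbolic T" "order z T < 2"
proof -
  obtain m where n: "n = Suc m" using assms by (cases n) auto
  have "\<exists>y. \<forall>i. i < m \<longrightarrow> x i + \<alpha> \<le> y i \<and> y i \<le> x (Suc i) \<and> poly T (y i) = 0"
    using T_root_between unfolding n by (intro choice) blast
  then obtain y where y: "\<And>i. i < m \<Longrightarrow> x i + \<alpha> \<le> y i" "\<And>i. i < m \<Longrightarrow> y i \<le> x (Suc i)"
    "\<And>i. i < m \<Longrightarrow> poly T (y i) = 0" by blast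
  have y_less: "y i < y j" if "i < j" "j < m" for i j
  proof -
    have "y i \<le> x (Suc i)" using y(2) that by simp
    also have "\<dots> \<le> x j" using x_mono that n by simp
    also have "\<dots> < x j + \<alpha>" using \<alpha>_pos by simp
    also have "\<dots> \<le> y j" using y(1) that by simp
    finally show ?thesis .
  qed
  have inj: "inj_on y {..<m}"
    by (intro inj_onI) (metis lessThan_iff less_irrefl linorder_neqE_nat y_less)
  define R where "R = y ` {..<m}"
  have R: "finite R" "card R = m" "\<And>r. r \<in> R \<Longrightarrow> poly T r = 0"
    using inj y(3) by (auto simp: R_def card_image)
  have "\<exists>R'. finite R' \<and> (\<forall>r\<in>R'. poly T r = 0) \<and> degree T \<le> card R'"
  proof (cases "lam = 1")
    case True
    then show ?thesis using R degree_T_less n by (intro exI[of _ R]) auto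
  next
    case False
    obtain q where q: "T = (\<Prod>r\<in>R. [:- r, 1:]) * q"
      using prod_linear_factors_dvd[of R T] R by (auto elim: dvdE)
    have "degree T = n"
      using degree_T_le le_degree[of T n] coeff_T_n False c_nz by simp
    moreover have "q \<noteq> 0" "(\<Prod>r\<in>R. [:- r, 1:]) \<noteq> 0" using q T_nz[OF assms] by auto
    ultimately have "degree q = 1"
      using R n degree_mult_eq[of "\<Prod>r\<in>R. [:- r, 1:]" q] q by (simp add: degree_prod_linear_factors)
    then obtain b d where bd: "q = [:b, d:]" "d \<noteq> 0"
      using degree1_coeffs by blast
    have "lead_coeff T = d"
      using bd unfolding q lead_coeff_mult by (simp add: lead_coeff_prod)
    then have d: "d = (1 - lam) * c"
      using coeff_T_n \<open>degree T = n\<close> by simp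
    define r where "r = - b / d"
    have poly_T: "poly T z = d * (z - r) * (\<Prod>i<m. z - y i)" for z
    proof -
      have "poly T z = (\<Prod>r\<in>R. z - r) * (b + z * d)"
        by (simp add: q poly_prod bd algebra_simps)
      also have "(\<Prod>r\<in>R. z - r) = (\<Prod>i<m. z - y i)"
        unfolding R_def using inj by (subst prod.reindex) auto
      finally show ?thesis using bd by (simp add: r_def distrib_left right_diff_distrib mult_ac)
    qed
    \<comment> \<open>To the right of all gaps \<open>T\<close> has the sign of \<open>c\<close> at \<open>X\<close>, but the sign of \<open>d\<close>,
      opposite to \<open>c\<close>, at infinity; for \<open>lam < 1\<close> the mirror image of this happens on the left.\<close>
    have "r \<notin> R"
    proof (cases "lam > 1")
      case True
      define X where "X = x m + \<alpha>"
      have "poly T X = c * (\<Prod>i<n. X - x i)"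
      proof -
        have "poly p (x m) = 0" using n poly_p_eq_0_iff by blast
        then show ?thesis by (simp add: poly_shift_diff X_def poly_p)
      qed
      then have "c * (\<Prod>i<n. X - x i) = c * ((1 - lam) * (X - r) * (\<Prod>i<m. X - y i))"
        by (simp add: poly_T d algebra_simps)
      then have "(\<Prod>i<n. X - x i) = (1 - lam) * (X - r) * (\<Prod>i<m. X - y i)"
        using c_nz by simp
      moreover have "(\<Prod>i<n. X - x i) > 0"
      proof (rule prod_pos)
        fix i assume "i \<in> {..<n}"
        then have "x i \<le> x m" using x_mono n by simp
        then show "X - x i > 0" using \<alpha>_pos unfolding X_def by simp
      qed
      moreover have yX: "y i < X" if "i < m" for i
        using y(2)[OF that] x_mono[of "Suc i" m] that n \<alpha>_pos by (auto simp: X_def)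
      moreover have "(\<Prod>i<m. X - y i) > 0"
        using yX by (intro prod_pos) auto
      ultimately have "X < r"
        using True by (simp add: zero_less_mult_iff)
      then show ?thesis using yX unfolding R_def by force
    next
      case False
      with \<open>lam \<noteq> 1\<close> have lam: "lam < 1" by simp
      define X where "X = x 0"
      have neg: "(\<Prod>i<k. a - f i) = (-1) ^ k * (\<Prod>i<k. f i - a)" for k a and f :: "nat \<Rightarrow> real"
        by (induction k) (auto simp: algebra_simps)
      have "poly T X = - lam * c * (\<Prod>i<n. X - \<alpha> - x i)"
      proof -
        have "poly p X = 0" using n poly_p_eq_0_iff X_def by blast
        then show ?thesis by (simp add: poly_shift_diff poly_p)
      qed
      \<comment> \<open>The product over the zeros of \<open>p\<close> has \<open>m + 1\<close> negative factors, the product over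
        the gap zeros only \<open>m\<close>: the extra sign turns \<open>- lam\<close> into \<open>lam\<close>.\<close>
      then have "c * (-1) ^ m * (lam * (\<Prod>i<n. x i - (X - \<alpha>))) =
          c * (-1) ^ m * ((1 - lam) * (X - r) * (\<Prod>i<m. y i - X))"
        unfolding poly_T neg[of "X - \<alpha>"] neg[of X] d n by (simp add: algebra_simps)
      then have "lam * (\<Prod>i<n. x i - (X - \<alpha>)) = (1 - lam) * (X - r) * (\<Prod>i<m. y i - X)"
        using c_nz by simp
      moreover have "lam * (\<Prod>i<n. x i - (X - \<alpha>)) > 0"
        using x_mono[of 0] \<alpha>_pos lam_pos unfolding X_def
        by (intro mult_pos_pos prod_pos) (auto simp: algebra_simps intro: le_less_trans add_strict_increasing)
      moreover have yX: "X < y i" if "i < m" for i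
        using y(1)[OF that] x_mono[of 0 i] that n \<alpha>_pos by (auto simp: X_def)
      moreover have "(\<Prod>i<m. y i - X) > 0"
        using yX by (intro prod_pos) auto
      ultimately have "r < X"
        using lam by (simp add: zero_less_mult_iff)
      then show ?thesis using yX unfolding R_def by force
    qed
    then show ?thesis
      using R n \<open>degree T = n\<close> poly_T[of r] by (intro exI[of _ "insert r R"]) auto
  qed
  then obtain R' where "finite R'" "\<forall>r\<in>R'. poly T r = 0" "degree T \<le> card R'" by blast
  then show "hyperbolic T" "order z T < 2"
    using simple_hyperbolic_if_enough_roots[of T R'] T_nz[OF assms] by auto
qed

text \<open>The two comparisons of \<open>\<Prod>i. g (y1 - x i)\<close> with \<open>\<Prod>i. g (y2 - x i)\<close> described at the
  beginning, preceded by the exclusion of zeros of \<open>T\<close> at which both \<open>p y\<close> and \<open>p (y - \<alpha>)\<close>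
  vanish, where the quotient makes no sense.\<close>

lemma T_roots_not_closer:
  assumes "n > 0" and y12: "y1 < y2"
    and roots: "poly T y1 = 0" "poly T y2 = 0"
    and gap: "\<And>i j. i < j \<Longrightarrow> j < n \<Longrightarrow> y2 - y1 < x j - x i"
  shows False
proof -
  have outside: "y1 \<le> x i \<or> x i + \<alpha> \<le> y1" "y2 \<le> x i \<or> x i + \<alpha> \<le> y2" if "i < n" for i
    using T_nonzero_right_of_root[OF that] roots by (meson not_le)+
  have p_shift: "poly p (y1 - \<alpha>) = 0 \<longleftrightarrow> poly p y1 = 0" "poly p (y2 - \<alpha>) = 0 \<longleftrightarrow> poly p y2 = 0"
    using roots lam_pos by (auto simp: poly_shift_diff)
  \<comment> \<open>A common zero of \<open>p\<close> and its translate exhibits two zeros of \<open>p\<close> at distance \<open>\<alpha>\<close>.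
    The other zero of \<open>T\<close> is then so close that it falls into a forbidden interval.\<close>
  have close: "y2 - y1 < \<alpha>" if "poly p z = 0" "poly p (z - \<alpha>) = 0" for z
  proof -
    obtain i j where ij: "i < n" "z = x i" "j < n" "z - \<alpha> = x j"
      using \<open>poly p z = 0\<close> \<open>poly p (z - \<alpha>) = 0\<close> by (auto simp: poly_p_eq_0_iff)
    moreover have "j < i"
      using ij spaced[of i j] \<alpha>_pos by (cases j i rule: linorder_cases) auto
    ultimately show ?thesis using gap[of j i] by simp
  qed
  have nz1: "poly p y1 \<noteq> 0"
  proof
    assume "poly p y1 = 0"
    then obtain i where "i < n" "y1 = x i" by (auto simp: poly_p_eq_0_iff)
    then show False
      using outside(2)[of i] y12 close[of y1] \<open>poly p y1 = 0\<close> p_shift by auto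
  qed
  have nz2: "poly p y2 \<noteq> 0"
  proof
    assume "poly p y2 = 0"
    then obtain j where "j < n" "y2 - \<alpha> = x j" using p_shift by (auto simp: poly_p_eq_0_iff)
    then show False
      using outside(1)[of j] y12 close[of y2] \<open>poly p y2 = 0\<close> p_shift by auto
  qed
  define g where "g = (\<lambda>t. t / (t - \<alpha>))"
  have prod_g: "(\<Prod>i<n. g (y - x i)) = lam" if "poly p (y - \<alpha>) \<noteq> 0" "poly T y = 0" for y
  proof -
    have "(\<Prod>i<n. g (y - x i)) = (\<Prod>i<n. y - x i) / (\<Prod>i<n. y - \<alpha> - x i)"
      by (simp add: g_def prod_dividef algebra_simps)
    also have "\<dots> = poly p y / poly p (y - \<alpha>)"
      using c_nz by (simp add: poly_p)
    finally show ?thesis using that by (simp add: poly_shift_diff)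
  qed
  have eq: "(\<Prod>i<n. g (y1 - x i)) = (\<Prod>i<n. g (y2 - x i))"
    using prod_g nz1 nz2 p_shift roots by simp
  have ne: "y1 \<noteq> x i" "y1 \<noteq> x i + \<alpha>" "y2 \<noteq> x i" "y2 \<noteq> x i + \<alpha>" if "i < n" for i
    using nz1 nz2 p_shift that by (auto simp: poly_p_eq_0_iff)
  have sides: "y1 - x i < 0 \<or> \<alpha> < y1 - x i" "y2 - x i < 0 \<or> \<alpha> < y2 - x i" if "i < n" for i
    using outside[OF that] ne[OF that] by auto
  have g_dec: "g t < g s" if "s < t" "t < 0 \<or> \<alpha> < s" for s t
    using that \<alpha>_pos unfolding g_def by (auto simp: divide_simps algebra_simps)
  have g_pos: "0 < g t" if "t < 0 \<or> \<alpha> < t" for t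
    using that \<alpha>_pos unfolding g_def by (auto simp: divide_simps)
  show False
  proof (cases "\<exists>k<n. y1 - x k < 0 \<and> \<alpha> < y2 - x k")
    case False
    \<comment> \<open>No argument of \<open>g\<close> crosses the interval \<open>(0, \<alpha>)\<close>, so \<open>g\<close> decreases in each factor.\<close>
    have dec: "g (y2 - x i) < g (y1 - x i)" if "i < n" for i
      using sides[OF that] False that y12 by (intro g_dec) auto
    have "(\<Prod>i<n. g (y2 - x i)) < (\<Prod>i<n. g (y1 - x i))"
      using dec g_pos sides \<open>n > 0\<close> by (intro prod_mono_strict[of 0]) (auto intro: less_imp_le)
    then show False using eq by simp
  next
    case True
    then obtain k where k: "k < n" "y1 < x k" "x k + \<alpha> < y2" by (auto simp: algebra_simps)
    obtain m where n: "n = Suc m" using \<open>n > 0\<close> by (cases n) auto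
    \<comment> \<open>Moving on to the next zero of \<open>p\<close> overcompensates the step from \<open>y1\<close> to \<open>y2\<close>. Up to
      \<open>k\<close> both arguments lie beyond \<open>\<alpha>\<close>, and from \<open>k\<close> on both are negative.\<close>
    have shifted: "g (y1 - x i) < g (y2 - x (Suc i))" if "i < m" for i
    proof (rule g_dec)
      show "y2 - x (Suc i) < y1 - x i" using gap[of i "Suc i"] that n by simp
      show "y1 - x i < 0 \<or> \<alpha> < y2 - x (Suc i)"
        using x_mono[of k i] x_mono[of "Suc i" k] k that n by (cases "k \<le> i") auto
    qed
    have pos1: "0 < g (y1 - x i)" if "i < n" for i using g_pos sides that by blast
    have pos2: "0 < g (y2 - x i)" if "i < n" for i using g_pos sides that by blast
    have first: "1 < g (y2 - x 0)"
      using x_mono[of 0 k] k \<alpha>_pos unfolding g_def by (auto simp: divide_simps)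
    have last: "g (y1 - x m) < 1"
      using x_mono[of k m] k n \<alpha>_pos unfolding g_def by (auto simp: divide_simps)
    have P: "0 < (\<Prod>i<m. g (y1 - x i))" using pos1 n by (intro prod_pos) auto
    have "(\<Prod>i<n. g (y1 - x i)) = (\<Prod>i<m. g (y1 - x i)) * g (y1 - x m)"
      by (simp add: n)
    also have "\<dots> < (\<Prod>i<m. g (y1 - x i))"
      using P last by simp
    also have "\<dots> \<le> (\<Prod>i<m. g (y2 - x (Suc i)))"
      using shifted pos1 n by (intro prod_mono) (auto intro: less_imp_le)
    also have "\<dots> < g (y2 - x 0) * (\<Prod>i<m. g (y2 - x (Suc i)))"
    proof -
      have "0 < (\<Prod>i<m. g (y2 - x (Suc i)))" using pos2 n by (intro prod_pos) auto
      then show ?thesis using mult_strict_right_mono[OF first] by fastforce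
    qed
    also have "\<dots> = (\<Prod>i<n. g (y2 - x i))"
      unfolding n by (subst prod.lessThan_Suc_shift) simp
    finally show False using eq by simp
  qed
qed

lemma T_roots_nonneg:
  assumes "lam \<ge> 1" "n > 0" "\<And>i. i < n \<Longrightarrow> 0 \<le> x i" "poly T y = 0"
  shows "0 \<le> y"
proof (rule ccontr)
  assume "\<not> 0 \<le> y"
  then have y: "y < x i" if "i < n" for i using assms(3)[OF that] by simp
  have "(\<Prod>i<n. \<bar>y - x i\<bar>) < (\<Prod>i<n. \<bar>y - \<alpha> - x i\<bar>)"
    using \<alpha>_pos y \<open>n > 0\<close> by (intro prod_mono_strict[of 0]) (force)+
  then have less: "\<bar>poly p y\<bar> < \<bar>poly p (y - \<alpha>)\<bar>"
    using c_nz by (simp add: poly_p abs_mult abs_prod)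
  have "\<bar>poly p y\<bar> = lam * \<bar>poly p (y - \<alpha>)\<bar>"
    using assms(4) lam_pos by (simp add: poly_shift_diff abs_mult)
  moreover have "1 * \<bar>poly p (y - \<alpha>)\<bar> \<le> lam * \<bar>poly p (y - \<alpha>)\<bar>"
    using assms(1) by (intro mult_right_mono) auto
  ultimately show False using less by simp
qed

end

section \<open>Mesh and the transfer to indexed zeros\<close>

text \<open>A multiple zero forces degree at least \<open>2\<close>, which is where mesh \<open>0\<close> is assigned to
  it.\<close>

lemma order_less_2_if_mesh_pos:
  assumes "mesh p > 0" "p \<noteq> 0"
  shows "order x p < 2"
proof (rule ccontr)
  assume "\<not> order x p < 2"
  then have "order x p \<ge> 2" by simp
  moreover from this have "\<not> degree p \<le> 1"
    using order_degree[OF assms(2), of x] by linarith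
  ultimately have "mesh p = 0" unfolding mesh_def by auto
  then show False using assms by simp
qed

lemma mesh_le_root_distance:
  assumes "poly p a = 0" "poly p b = 0" "a \<noteq> b" "p \<noteq> 0"
  shows "mesh p \<le> ereal \<bar>a - b\<bar>"
proof -
  have "card {a, b} \<le> card {x. poly p x = 0}"
    using assms poly_roots_finite[OF assms(4)] by (intro card_mono) auto
  then have "\<not> degree p \<le> 1"
    using card_poly_roots_bound[OF assms(4)] assms(3) by auto
  moreover have "Inf {ereal \<bar>x - y\<bar> |x y. poly p x = 0 \<and> poly p y = 0 \<and> x \<noteq> y} \<le> ereal \<bar>a - b\<bar>"
    using assms by (intro Inf_lower) auto
  ultimately show ?thesis unfolding mesh_def by auto
qed

lemma spaced_poly_if_HP_ge:
  assumes "\<alpha> > 0" "lam > 0" "p \<in> HP_ge \<alpha>" "p \<noteq> 0"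
  obtains x where "spaced_poly \<alpha> lam (lead_coeff p) (degree p) x p"
proof -
  have hyp: "hyperbolic p" and mesh: "ereal \<alpha> \<le> mesh p"
    using assms by (auto simp: HP_ge_def HP_def)
  have "mesh p > 0"
    using mesh assms(1) by (metis ereal_less(2) less_le_trans)
  define S where "S = {x. poly p x = 0}"
  have p: "p = smult (lead_coeff p) (\<Prod>x\<in>S. [:- x, 1:])"
    unfolding S_def
    using factorization_of_simple_hyperbolic[OF hyp assms(4) order_less_2_if_mesh_pos]
      \<open>mesh p > 0\<close> assms(4) by blast
  have "degree p = degree (smult (lead_coeff p) (\<Prod>x\<in>S. [:- x, 1:]))"
    by (rule arg_cong[OF p])
  then have deg: "degree p = card S"
    using assms(4) by (simp only: degree_smult_eq degree_prod_linear_factors) simp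
  have "finite S" unfolding S_def using assms(4) by (rule poly_roots_finite)
  then obtain x where x: "bij_betw x {..<card S} S" "\<And>i j. i < j \<Longrightarrow> j < card S \<Longrightarrow> x i < x j"
    by (rule finite_set_increasing_enumeration) blast
  have "spaced_poly \<alpha> lam (lead_coeff p) (degree p) x p"
  proof
    show "\<alpha> > 0" "lam > 0" "lead_coeff p \<noteq> 0" using assms by auto
    have "(\<Prod>x\<in>S. [:- x, 1:]) = (\<Prod>i<degree p. [:- x i, 1:])"
      using prod.reindex_bij_betw[OF x(1), of "\<lambda>x. [:- x, 1:]"] deg by simp
    from p show "p = smult (lead_coeff p) (\<Prod>i<degree p. [:- x i, 1:])"
      unfolding \<open>(\<Prod>x\<in>S. [:- x, 1:]) = (\<Prod>i<degree p. [:- x i, 1:])\<close> .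
    fix i j :: nat assume ij: "i < j" "j < degree p"
    then have less: "x i < x j" using x(2) deg by simp
    have "x i \<in> S" "x j \<in> S"
      using x(1) ij deg by (auto simp: bij_betw_def)
    then have "mesh p \<le> ereal \<bar>x i - x j\<bar>"
      using mesh_le_root_distance[of p "x i" "x j"] less assms(4) unfolding S_def by simp
    with mesh have "ereal \<alpha> \<le> ereal \<bar>x i - x j\<bar>" by (rule order.trans)
    then show "x i + \<alpha> \<le> x j" using less by simp
  qed
  then show thesis by (rule that)
qed

section \<open>The operator on polynomials with large mesh\<close>

lemma hyperbolic_degree_0:
  assumes "degree p = 0"
  shows "hyperbolic p"
  using assms by (auto simp: hyperbolic_def map_poly_pCons elim!: degree_eq_zeroE)

lemma shift_diff_degree_0:
  assumes "degree p = 0"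
  shows "degree (shift_diff \<alpha> lam p) = 0"
  using assms by (auto simp: shift_diff_def elim!: degree_eq_zeroE)

lemma shift_diff_hyperbolic_mesh_mono:
  assumes "\<alpha> > 0" "lam > 0" "p \<in> HP_ge \<alpha>"
  shows "hyperbolic (shift_diff \<alpha> lam p)" "mesh (shift_diff \<alpha> lam p) \<ge> mesh p"
proof -
  have "hyperbolic (shift_diff \<alpha> lam p) \<and> mesh (shift_diff \<alpha> lam p) \<ge> mesh p"
  proof (cases "degree p = 0")
    case True
    then show ?thesis
      using shift_diff_degree_0[OF True] hyperbolic_degree_0 by (auto simp: mesh_def)
  next
    case False
    then have "p \<noteq> 0" by auto
    then obtain x where "spaced_poly \<alpha> lam (lead_coeff p) (degree p) x p"
      using spaced_poly_if_HP_ge assms by blast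
    then interpret spaced_poly \<alpha> lam "lead_coeff p" "degree p" x p .
    have ordered: "mesh p \<le> ereal \<bar>a - b\<bar>" if "poly T a = 0" "poly T b = 0" "a < b" for a b
    proof (rule ccontr)
      assume "\<not> mesh p \<le> ereal \<bar>a - b\<bar>"
      then have less: "ereal \<bar>a - b\<bar> < mesh p" by simp
      have "b - a < x j - x i" if "i < j" "j < degree p" for i j
      proof -
        have xx: "x i < x j" using spaced that \<alpha>_pos by fastforce
        then have "mesh p \<le> ereal \<bar>x i - x j\<bar>"
          using that \<open>p \<noteq> 0\<close> poly_p_eq_0_iff by (intro mesh_le_root_distance) (auto intro: less_trans)
        with less have "ereal \<bar>a - b\<bar> < ereal \<bar>x i - x j\<bar>" by (rule less_le_trans)
        then show ?thesis using xx \<open>a < b\<close> by simp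
      qed
      then show False using T_roots_not_closer[of a b] that False by simp
    qed
    then have "mesh p \<le> ereal \<bar>a - b\<bar>" if "poly T a = 0" "poly T b = 0" "a \<noteq> b" for a b
      using ordered[of a b] ordered[of b a] that by (cases "a < b") (simp_all add: abs_minus_commute)
    then have "mesh p \<le> Inf {ereal \<bar>a - b\<bar> |a b. poly T a = 0 \<and> poly T b = 0 \<and> a \<noteq> b}"
      by (intro Inf_greatest) auto
    moreover have "\<not> (\<exists>z. order z T \<ge> 2)"
      using T_simple_hyperbolic(2) False by (simp add: not_le)
    ultimately have "mesh p \<le> mesh T"
      by (simp add: mesh_def[of T])
    then show ?thesis using T_simple_hyperbolic(1) False by simp
  qed
  then show "hyperbolic (shift_diff \<alpha> lam p)" "mesh (shift_diff \<alpha> lam p) \<ge> mesh p" by auto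
qed

lemma shift_diff_roots_nonneg:
  assumes "\<alpha> > 0" "lam \<ge> 1" "p \<in> HP_ge_nonneg \<alpha>" "poly (shift_diff \<alpha> lam p) y = 0"
    "shift_diff \<alpha> lam p \<noteq> 0"
  shows "0 \<le> y"
proof (cases "degree p = 0")
  case True
  then show ?thesis
    using shift_diff_degree_0[OF True, of \<alpha> lam] assms(4,5) by (auto elim!: degree_eq_zeroE)
next
  case False
  then have "p \<noteq> 0" by auto
  then obtain x where "spaced_poly \<alpha> lam (lead_coeff p) (degree p) x p"
    using spaced_poly_if_HP_ge[of \<alpha> lam p] assms by (auto simp: HP_ge_nonneg_def)
  then interpret spaced_poly \<alpha> lam "lead_coeff p" "degree p" x p .
  have "0 \<le> x i" if "i < degree p" for i
    using assms(3) \<open>p \<noteq> 0\<close> poly_p_eq_0_iff[of "x i"] that by (auto simp: HP_ge_nonneg_def)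
  then show ?thesis using T_roots_nonneg assms False by blast
qed

theorem theorem2:
  fixes \<alpha> lam :: real
  assumes "\<alpha> > 0" and "lam > 0"
  shows "(\<forall>p \<in> HP_ge \<alpha>. shift_diff \<alpha> lam p \<in> HP \<and> mesh (shift_diff \<alpha> lam p) \<ge> mesh p) \<and>
         (lam \<ge> 1 \<longrightarrow> shift_diff \<alpha> lam ` HP_ge_nonneg \<alpha> \<subseteq> HP_ge_nonneg \<alpha>)"
proof (intro conjI ballI impI)
  fix p assume p: "p \<in> HP_ge \<alpha>"
  show "shift_diff \<alpha> lam p \<in> HP" "mesh (shift_diff \<alpha> lam p) \<ge> mesh p"
    using shift_diff_hyperbolic_mesh_mono[OF assms p] by (auto simp: HP_def)
next
  assume lam: "lam \<ge> 1"
  show "shift_diff \<alpha> lam ` HP_ge_nonneg \<alpha> \<subseteq> HP_ge_nonneg \<alpha>"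
  proof (rule image_subsetI)
    fix p assume p: "p \<in> HP_ge_nonneg \<alpha>"
    then have "p \<in> HP_ge \<alpha>" by (simp add: HP_ge_nonneg_def)
    then have "shift_diff \<alpha> lam p \<in> HP_ge \<alpha>"
      using shift_diff_hyperbolic_mesh_mono[OF assms, of p]
      by (auto simp: HP_ge_def HP_def intro: order.trans)
    then show "shift_diff \<alpha> lam p \<in> HP_ge_nonneg \<alpha>"
      using shift_diff_roots_nonneg[OF assms(1) lam p] by (auto simp: HP_ge_nonneg_def)
  qed
qed

end
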